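(* Let $T$ be a recursively enumerable extension of Robinson's arithmetic $\mathbf{Q}$, and suppose that $T$ satisfies the following two conditions: (I) $T\vdash\neg\mathrm{Con}_T\rightarrow\mathrm{Pr}_T(\#\varphi)$ for every sentence $\varphi$; and (II) $T\vdash\mathrm{Con}_T\rightarrow\neg\mathrm{Pr}_T(\#\gamma)$ for every Gödelian sentence $\gamma$ of $T$. Then: (a) If $T\vdash\neg\mathrm{Con}_T$, then every false $\Pi_1$-sentence is a Gödelian sentence of $T$, and no Gödelian sentence of $T$ is independent from $T$. (b) If $T\nvdash\neg\mathrm{Con}_T$, then all the Gödelian $\Pi_1$-sentences of $T$ are true, and all the Gödelian sentences of $T$ are independent from $T$.
   Context: All theories and sentences are in the language of first-order arithmetic; "true" and "false" mean true and false in the standard model $\mathbb{N}$. A fixed Gödel numbering of the syntax is given, and $\#A$ denotes the numeral of the Gödel code of the expression $A$. $\mathrm{Pr}_T(x)$ is a fixed provability predicate of $T$ relative to this numbering: a $\Sigma_1$-formula such that for every sentence $\varphi$: $T\vdash\varphi \iff \mathbb{N}\vDash\mathrm{Pr}_T(\#\varphi) \iff \mathbf{Q}\vdash\mathrm{Pr}_T(\#\varphi)$. $\mathrm{Con}_T$ is the $\Pi_1$-sentence $\neg\mathrm{Pr}_T(\#[0\neq 0])$. A sentence $\gamma$ is a Gödelian sentence of $T$ when $T\vdash\gamma\leftrightarrow\neg\mathrm{Pr}_T(\#\gamma)$; a Gödelian $\Pi_1$-sentence is a Gödelian sentence that is a $\Pi_1$-sentence. A sentence $\varphi$ is independent from $T$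 when $T\nvdash\varphi$ and $T\nvdash\neg\varphi$. *)

theory Defs
  imports Main
begin

section \<open>Syntax of first-order arithmetic\<close>

text \<open>Variables are de Bruijn indices: inside the scope of a quantifier, index 0 is the variable
  bound by it.  The language is 0, S, +, \<open>\<cdot>\<close>, \<open>\<le>\<close>, with equality.\<close>

datatype tm =
    Var nat
  | Zero
  | Succ tm
  | Plus tm tm
  | Times tm tm

datatype fm =
    Eq tm tm
  | Le tm tm
  | Neg fm
  | Conj fm fm
  | Disj fm fm
  | Imp fm fm
  | Forall fm
  | Exists fm

definition Iff :: "fm \<Rightarrow> fm \<Rightarrow> fm" where
  "Iff \<phi> \<psi> = Conj (Imp \<phi> \<psi>) (Imp \<psi> \<phi>)"

primrec fv_tm :: "tm \<Rightarrow> nat set" where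
  "fv_tm (Var n) = {n}"
| "fv_tm Zero = {}"
| "fv_tm (Succ t) = fv_tm t"
| "fv_tm (Plus s t) = fv_tm s \<union> fv_tm t"
| "fv_tm (Times s t) = fv_tm s \<union> fv_tm t"

primrec fv :: "fm \<Rightarrow> nat set" where
  "fv (Eq s t) = fv_tm s \<union> fv_tm t"
| "fv (Le s t) = fv_tm s \<union> fv_tm t"
| "fv (Neg \<phi>) = fv \<phi>"
| "fv (Conj \<phi> \<psi>) = fv \<phi> \<union> fv \<psi>"
| "fv (Disj \<phi> \<psi>) = fv \<phi> \<union> fv \<psi>"
| "fv (Imp \<phi> \<psi>) = fv \<phi> \<union> fv \<psi>"
| "fv (Forall \<phi>) = {n. Suc n \<in> fv \<phi>}"
| "fv (Exists \<phi>) = {n. Suc n \<in> fv \<phi>}"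

definition sentence :: "fm \<Rightarrow> bool" where
  "sentence \<phi> \<longleftrightarrow> fv \<phi> = {}"

primrec subst_tm :: "(nat \<Rightarrow> tm) \<Rightarrow> tm \<Rightarrow> tm" where
  "subst_tm \<sigma> (Var n) = \<sigma> n"
| "subst_tm \<sigma> Zero = Zero"
| "subst_tm \<sigma> (Succ t) = Succ (subst_tm \<sigma> t)"
| "subst_tm \<sigma> (Plus s t) = Plus (subst_tm \<sigma> s) (subst_tm \<sigma> t)"
| "subst_tm \<sigma> (Times s t) = Times (subst_tm \<sigma> s) (subst_tm \<sigma> t)"

definition lift_tm :: "tm \<Rightarrow> tm" where
  "lift_tm = subst_tm (\<lambda>n. Var (Suc n))"

text \<open>The substitution that \<open>\<sigma>\<close> induces on the body of a quantifier.\<close>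

definition under_binder :: "(nat \<Rightarrow> tm) \<Rightarrow> nat \<Rightarrow> tm" where
  "under_binder \<sigma> n = (case n of 0 \<Rightarrow> Var 0 | Suc k \<Rightarrow> lift_tm (\<sigma> k))"

primrec subst :: "(nat \<Rightarrow> tm) \<Rightarrow> fm \<Rightarrow> fm" where
  "subst \<sigma> (Eq s t) = Eq (subst_tm \<sigma> s) (subst_tm \<sigma> t)"
| "subst \<sigma> (Le s t) = Le (subst_tm \<sigma> s) (subst_tm \<sigma> t)"
| "subst \<sigma> (Neg \<phi>) = Neg (subst \<sigma> \<phi>)"
| "subst \<sigma> (Conj \<phi> \<psi>) = Conj (subst \<sigma> \<phi>) (subst \<sigma> \<psi>)"
| "subst \<sigma> (Disj \<phi> \<psi>) = Disj (subst \<sigma> \<phi>) (subst \<sigma> \<psi>)"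
| "subst \<sigma> (Imp \<phi> \<psi>) = Imp (subst \<sigma> \<phi>) (subst \<sigma> \<psi>)"
| "subst \<sigma> (Forall \<phi>) = Forall (subst (under_binder \<sigma>) \<phi>)"
| "subst \<sigma> (Exists \<phi>) = Exists (subst (under_binder \<sigma>) \<phi>)"

definition lift :: "fm \<Rightarrow> fm" where
  "lift = subst (\<lambda>n. Var (Suc n))"

text \<open>\<open>inst \<phi> t\<close> replaces variable 0 by \<open>t\<close> and lowers the other indices by one.\<close>

definition inst :: "fm \<Rightarrow> tm \<Rightarrow> fm" where
  "inst \<phi> t = subst (\<lambda>n. case n of 0 \<Rightarrow> t | Suc k \<Rightarrow> Var k) \<phi>"

primrec nat_tm :: "nat \<Rightarrow> tm" where
  "nat_tm 0 = Zero"
| "nat_tm (Suc n) = Succ (nat_tm n)"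


section \<open>The standard model\<close>

primrec val :: "(nat \<Rightarrow> nat) \<Rightarrow> tm \<Rightarrow> nat" where
  "val e (Var n) = e n"
| "val e Zero = 0"
| "val e (Succ t) = Suc (val e t)"
| "val e (Plus s t) = val e s + val e t"
| "val e (Times s t) = val e s * val e t"

primrec sat :: "(nat \<Rightarrow> nat) \<Rightarrow> fm \<Rightarrow> bool" where
  "sat e (Eq s t) \<longleftrightarrow> val e s = val e t"
| "sat e (Le s t) \<longleftrightarrow> val e s \<le> val e t"
| "sat e (Neg \<phi>) \<longleftrightarrow> \<not> sat e \<phi>"
| "sat e (Conj \<phi> \<psi>) \<longleftrightarrow> sat e \<phi> \<and> sat e \<psi>"
| "sat e (Disj \<phi> \<psi>) \<longleftrightarrow> sat e \<phi> \<or> sat e \<psi>"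
| "sat e (Imp \<phi> \<psi>) \<longleftrightarrow> (sat e \<phi> \<longrightarrow> sat e \<psi>)"
| "sat e (Forall \<phi>) \<longleftrightarrow> (\<forall>a. sat (case_nat a e) \<phi>)"
| "sat e (Exists \<phi>) \<longleftrightarrow> (\<exists>a. sat (case_nat a e) \<phi>)"

definition true_in_N :: "fm \<Rightarrow> bool" where
  "true_in_N \<phi> \<longleftrightarrow> (\<forall>e. sat e \<phi>)"


section \<open>Provability in classical first-order logic with equality\<close>

text \<open>Natural deduction; the set of assumptions may be infinite.  In the quantifier rules, lifting
  the context makes variable 0 the eigenvariable.\<close>

inductive proves :: "fm set \<Rightarrow> fm \<Rightarrow> bool" (infix "\<turnstile>" 50) where
  Assm: "\<phi> \<in> \<Gamma> \<Longrightarrow> \<Gamma> \<turnstile> \<phi>"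
| NegI: "insert \<phi> \<Gamma> \<turnstile> \<psi> \<Longrightarrow> insert \<phi> \<Gamma> \<turnstile> Neg \<psi> \<Longrightarrow> \<Gamma> \<turnstile> Neg \<phi>"
| Contr: "insert (Neg \<phi>) \<Gamma> \<turnstile> \<psi> \<Longrightarrow> insert (Neg \<phi>) \<Gamma> \<turnstile> Neg \<psi> \<Longrightarrow> \<Gamma> \<turnstile> \<phi>"
| ConjI: "\<Gamma> \<turnstile> \<phi> \<Longrightarrow> \<Gamma> \<turnstile> \<psi> \<Longrightarrow> \<Gamma> \<turnstile> Conj \<phi> \<psi>"
| ConjE1: "\<Gamma> \<turnstile> Conj \<phi> \<psi> \<Longrightarrow> \<Gamma> \<turnstile> \<phi>"
| ConjE2: "\<Gamma> \<turnstile> Conj \<phi> \<psi> \<Longrightarrow> \<Gamma> \<turnstile> \<psi>"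
| DisjI1: "\<Gamma> \<turnstile> \<phi> \<Longrightarrow> \<Gamma> \<turnstile> Disj \<phi> \<psi>"
| DisjI2: "\<Gamma> \<turnstile> \<psi> \<Longrightarrow> \<Gamma> \<turnstile> Disj \<phi> \<psi>"
| DisjE: "\<Gamma> \<turnstile> Disj \<phi> \<psi> \<Longrightarrow> insert \<phi> \<Gamma> \<turnstile> \<chi> \<Longrightarrow> insert \<psi> \<Gamma> \<turnstile> \<chi> \<Longrightarrow> \<Gamma> \<turnstile> \<chi>"
| ImpI: "insert \<phi> \<Gamma> \<turnstile> \<psi> \<Longrightarrow> \<Gamma> \<turnstile> Imp \<phi> \<psi>"
| ImpE: "\<Gamma> \<turnstile> Imp \<phi> \<psi> \<Longrightarrow> \<Gamma> \<turnstile> \<phi> \<Longrightarrow> \<Gamma> \<turnstile> \<psi>"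
| ForallI: "lift ` \<Gamma> \<turnstile> \<phi> \<Longrightarrow> \<Gamma> \<turnstile> Forall \<phi>"
| ForallE: "\<Gamma> \<turnstile> Forall \<phi> \<Longrightarrow> \<Gamma> \<turnstile> inst \<phi> t"
| ExistsI: "\<Gamma> \<turnstile> inst \<phi> t \<Longrightarrow> \<Gamma> \<turnstile> Exists \<phi>"
| ExistsE: "\<Gamma> \<turnstile> Exists \<phi> \<Longrightarrow> insert \<phi> (lift ` \<Gamma>) \<turnstile> lift \<psi> \<Longrightarrow> \<Gamma> \<turnstile> \<psi>"
| EqRefl: "\<Gamma> \<turnstile> Eq t t"
| EqSubst: "\<Gamma> \<turnstile> Eq s t \<Longrightarrow> \<Gamma> \<turnstile> inst \<phi> s \<Longrightarrow> \<Gamma> \<turnstile> inst \<phi> t"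

definition independent_from :: "fm set \<Rightarrow> fm \<Rightarrow> bool" where
  "independent_from T \<phi> \<longleftrightarrow> \<not> T \<turnstile> \<phi> \<and> \<not> T \<turnstile> Neg \<phi>"


section \<open>Robinson's arithmetic\<close>

definition Q :: "fm set" where
  "Q =
    {Forall (Neg (Eq (Succ (Var 0)) Zero)),
     Forall (Forall (Imp (Eq (Succ (Var 1)) (Succ (Var 0))) (Eq (Var 1) (Var 0)))),
     Forall (Imp (Neg (Eq (Var 0) Zero)) (Exists (Eq (Var 1) (Succ (Var 0))))),
     Forall (Eq (Plus (Var 0) Zero) (Var 0)),
     Forall (Forall (Eq (Plus (Var 1) (Succ (Var 0))) (Succ (Plus (Var 1) (Var 0))))),
     Forall (Eq (Times (Var 0) Zero) Zero),
     Forall (Forall (Eq (Times (Var 1) (Succ (Var 0))) (Plus (Times (Var 1) (Var 0)) (Var 1)))),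
     \<comment> \<open>\<open>\<forall>x y. x \<le> y \<longleftrightarrow> (\<exists>z. z + x = y)\<close>\<close>
     Forall (Forall (Iff (Le (Var 1) (Var 0)) (Exists (Eq (Plus (Var 0) (Var 2)) (Var 1)))))}"

definition extends :: "fm set \<Rightarrow> fm set \<Rightarrow> bool" where
  "extends T U \<longleftrightarrow> (\<forall>\<phi>. sentence \<phi> \<longrightarrow> U \<turnstile> \<phi> \<longrightarrow> T \<turnstile> \<phi>)"


section \<open>Arithmetical hierarchy\<close>

text \<open>In a bounded quantifier the bounding term is lifted, so it does not contain the bound
  variable.\<close>

inductive Delta0 :: "fm \<Rightarrow> bool" where
  "Delta0 (Eq s t)"
| "Delta0 (Le s t)"
| "Delta0 \<phi> \<Longrightarrow> Delta0 (Neg \<phi>)"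
| "Delta0 \<phi> \<Longrightarrow> Delta0 \<psi> \<Longrightarrow> Delta0 (Conj \<phi> \<psi>)"
| "Delta0 \<phi> \<Longrightarrow> Delta0 \<psi> \<Longrightarrow> Delta0 (Disj \<phi> \<psi>)"
| "Delta0 \<phi> \<Longrightarrow> Delta0 \<psi> \<Longrightarrow> Delta0 (Imp \<phi> \<psi>)"
| "Delta0 \<phi> \<Longrightarrow> Delta0 (Forall (Imp (Le (Var 0) (lift_tm t)) \<phi>))"
| "Delta0 \<phi> \<Longrightarrow> Delta0 (Exists (Conj (Le (Var 0) (lift_tm t)) \<phi>))"

text \<open>Besides the prenex formulas, the negation of a \<open>\<Sigma>\<^sub>1\<close>-formula counts as \<open>\<Pi>\<^sub>1\<close> and conversely;
  this makes the consistency statement, a negated \<open>\<Sigma>\<^sub>1\<close>-sentence, literally \<open>\<Pi>\<^sub>1\<close>.\<close>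

inductive Sigma1 :: "fm \<Rightarrow> bool" and Pi1 :: "fm \<Rightarrow> bool" where
  "Delta0 \<phi> \<Longrightarrow> Sigma1 \<phi>"
| "Sigma1 \<phi> \<Longrightarrow> Sigma1 (Exists \<phi>)"
| "Pi1 \<phi> \<Longrightarrow> Sigma1 (Neg \<phi>)"
| "Delta0 \<phi> \<Longrightarrow> Pi1 \<phi>"
| "Pi1 \<phi> \<Longrightarrow> Pi1 (Forall \<phi>)"
| "Sigma1 \<phi> \<Longrightarrow> Pi1 (Neg \<phi>)"


section \<open>Recursive functions and recursively enumerable sets\<close>

datatype recf =
    ZeroF
  | SuccF
  | Proj nat
  | Comp recf "recf list"
  | PrimRec recf recf
  | Mu recf

text \<open>\<open>computes f xs y\<close>: the partial recursive function denoted by \<open>f\<close> is defined at the argument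
  list \<open>xs\<close> with value \<open>y\<close>.\<close>

inductive computes :: "recf \<Rightarrow> nat list \<Rightarrow> nat \<Rightarrow> bool" where
  "computes ZeroF xs 0"
| "computes SuccF (x # xs) (Suc x)"
| "i < length xs \<Longrightarrow> computes (Proj i) xs (xs ! i)"
| "list_all2 (\<lambda>g y. computes g xs y) gs ys \<Longrightarrow> computes f ys z \<Longrightarrow> computes (Comp f gs) xs z"
| "computes f xs y \<Longrightarrow> computes (PrimRec f g) (0 # xs) y"
| "computes (PrimRec f g) (n # xs) y \<Longrightarrow> computes g (n # y # xs) z
    \<Longrightarrow> computes (PrimRec f g) (Suc n # xs) z"
| "computes f (n # xs) 0 \<Longrightarrow> (\<forall>m<n. \<exists>y. computes f (m # xs) (Suc y)) \<Longrightarrow> computes (Mu f) xs n"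

text \<open>The domain of a partial recursive function.\<close>

definition recursively_enumerable :: "nat set \<Rightarrow> bool" where
  "recursively_enumerable A \<longleftrightarrow> (\<exists>f. \<forall>n. n \<in> A \<longleftrightarrow> (\<exists>y. computes f [n] y))"

definition recursive :: "nat set \<Rightarrow> bool" where
  "recursive A \<longleftrightarrow> (\<exists>f. \<forall>n. computes f [n] (if n \<in> A then 1 else 0))"


section \<open>Goedel numberings\<close>

text \<open>An operation on expressions is tracked when a partial recursive function computes the code
  of the result from the codes of the arguments.\<close>

definition tracked1 :: "('a \<Rightarrow> nat) \<Rightarrow> ('b \<Rightarrow> nat) \<Rightarrow> ('a \<Rightarrow> 'b) \<Rightarrow> bool" where
  "tracked1 c d F \<longleftrightarrow> (\<exists>f. \<forall>x. computes f [c x] (d (F x)))"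

definition tracked2 :: "('a \<Rightarrow> nat) \<Rightarrow> ('b \<Rightarrow> nat) \<Rightarrow> ('a \<Rightarrow> 'a \<Rightarrow> 'b) \<Rightarrow> bool" where
  "tracked2 c d F \<longleftrightarrow> (\<exists>f. \<forall>x y. computes f [c x, c y] (d (F x y)))"

text \<open>An effective injective coding: the codes form a recursive set and the syntactic constructors
  are tracked.  By search over all expressions, decoding is then recursive as well.\<close>

definition goedel_numbering :: "(tm \<Rightarrow> nat) \<Rightarrow> (fm \<Rightarrow> nat) \<Rightarrow> bool" where
  "goedel_numbering ct cf \<longleftrightarrow>
     inj ct \<and> inj cf \<and> recursive (range ct) \<and> recursive (range cf) \<and>
     tracked1 id ct Var \<and> tracked1 ct ct Succ \<and> tracked2 ct ct Plus \<and> tracked2 ct ct Times \<and>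
     tracked2 ct cf Eq \<and> tracked2 ct cf Le \<and> tracked1 cf cf Neg \<and>
     tracked2 cf cf Conj \<and> tracked2 cf cf Disj \<and> tracked2 cf cf Imp \<and>
     tracked1 cf cf Forall \<and> tracked1 cf cf Exists"

definition re_theory :: "(fm \<Rightarrow> nat) \<Rightarrow> fm set \<Rightarrow> bool" where
  "re_theory cf T \<longleftrightarrow> (\<forall>\<phi>\<in>T. sentence \<phi>) \<and> recursively_enumerable (cf ` T)"


section \<open>Provability predicates\<close>

text \<open>\<open>P\<close> is a formula whose only free variable is variable 0; \<open>apply_code cf P \<phi>\<close> is
  \<open>P(#\<phi>)\<close>.\<close>

definition apply_code :: "(fm \<Rightarrow> nat) \<Rightarrow> fm \<Rightarrow> fm \<Rightarrow> fm" where
  "apply_code cf P \<phi> = inst P (nat_tm (cf \<phi>))"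

definition provability_predicate :: "(fm \<Rightarrow> nat) \<Rightarrow> fm set \<Rightarrow> fm \<Rightarrow> bool" where
  "provability_predicate cf T P \<longleftrightarrow>
     Sigma1 P \<and> fv P \<subseteq> {0} \<and>
     (\<forall>\<phi>. sentence \<phi> \<longrightarrow>
        (T \<turnstile> \<phi> \<longleftrightarrow> true_in_N (apply_code cf P \<phi>)) \<and>
        (true_in_N (apply_code cf P \<phi>) \<longleftrightarrow> Q \<turnstile> apply_code cf P \<phi>))"

definition Con :: "(fm \<Rightarrow> nat) \<Rightarrow> fm \<Rightarrow> fm" where
  "Con cf P = Neg (apply_code cf P (Neg (Eq Zero Zero)))"

definition goedelian :: "(fm \<Rightarrow> nat) \<Rightarrow> fm \<Rightarrow> fm set \<Rightarrow> fm \<Rightarrow> bool" where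
  "goedelian cf P T \<gamma> \<longleftrightarrow> sentence \<gamma> \<and> T \<turnstile> Iff \<gamma> (Neg (apply_code cf P \<gamma>))"

end

theory Submission
  imports Defs
begin

text \<open>
  Everything rests on one fact about Robinson's arithmetic: it proves every true
  \<open>\<Sigma>\<^sub>1\<close>-sentence and refutes every false \<open>\<Pi>\<^sub>1\<close>-sentence
  (\<open>Q_refutes_false_Pi1\<close>), and therefore so does \<open>T\<close>.

  Suppose \<open>T\<close> proves its own inconsistency.  By (I) it then proves \<open>Pr(#\<phi>)\<close> for every
  sentence \<open>\<phi>\<close>, so over \<open>T\<close> being Goedelian just means being refutable.  False
  \<open>\<Pi>\<^sub>1\<close>-sentences are refutable, and refutable sentences are not independent.

  Suppose \<open>T\<close> does not prove its own inconsistency.  Then \<open>T\<close> is consistent, and a Goedelian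
  \<open>\<gamma>\<close> is unprovable because a proof of it would yield \<open>Pr(#\<gamma>)\<close> in \<open>T\<close>, hence \<open>\<not>\<gamma>\<close>.  A refutation
  of \<open>\<gamma>\<close> would also give \<open>Pr(#\<gamma>)\<close> in \<open>T\<close>, this time by the fixed-point equivalence, and the
  contrapositive of (II) would turn it into \<open>\<not>Con\<close>.  So \<open>\<gamma>\<close> is independent; since false
  \<open>\<Pi>\<^sub>1\<close>-sentences are refutable, a Goedelian \<open>\<Pi>\<^sub>1\<close>-sentence must be true.

  The completeness of \<open>Q\<close> is proved for formulas whose free variables are replaced by numerals, by
  induction on the formula.  Its arithmetical core is the evaluation of terms to numerals
  (\<open>Q_evaluates\<close>) and the fact that below a numeral there are only numerals (\<open>Le_numeral\<close>), which
  reduces a bounded quantifier to finitely many instances.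
\<close>

section \<open>Simultaneous substitution\<close>

lemma subst_tm_cong: "(\<And>n. n \<in> fv_tm t \<Longrightarrow> \<sigma> n = \<tau> n) \<Longrightarrow> subst_tm \<sigma> t = subst_tm \<tau> t"
  by (induction t) auto

lemma subst_tm_Var [simp]: "subst_tm Var t = t"
  by (induction t) auto

lemma subst_tm_subst_tm: "subst_tm \<tau> (subst_tm \<sigma> t) = subst_tm (\<lambda>n. subst_tm \<tau> (\<sigma> n)) t"
  by (induction t) auto

lemma subst_tm_lift_tm [simp]: "subst_tm \<tau> (lift_tm t) = subst_tm (\<lambda>n. \<tau> (Suc n)) t"
  by (simp add: lift_tm_def subst_tm_subst_tm)

lemma under_binder_simps [simp]:
  "under_binder \<sigma> 0 = Var 0" "under_binder \<sigma> (Suc n) = lift_tm (\<sigma> n)"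
  by (simp_all add: under_binder_def)

lemma subst_tm_under_binder:
  "subst_tm (under_binder \<tau>) (under_binder \<sigma> n) = under_binder (\<lambda>n. subst_tm \<tau> (\<sigma> n)) n"
  by (cases n) (simp_all add: lift_tm_def subst_tm_subst_tm)

lemma subst_subst: "subst \<tau> (subst \<sigma> \<phi>) = subst (\<lambda>n. subst_tm \<tau> (\<sigma> n)) \<phi>"
  by (induction \<phi> arbitrary: \<sigma> \<tau>) (simp_all add: subst_tm_subst_tm subst_tm_under_binder)

lemma under_binder_Var [simp]: "under_binder Var = Var"
proof
  show "under_binder Var n = Var n" for n by (cases n) (simp_all add: lift_tm_def)
qed

lemma subst_Var [simp]: "subst Var \<phi> = \<phi>"
  by (induction \<phi>) simp_all

lemma subst_cong: "(\<And>n. n \<in> fv \<phi> \<Longrightarrow> \<sigma> n = \<tau> n) \<Longrightarrow> subst \<sigma> \<phi> = subst \<tau> \<phi>"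
proof (induction \<phi> arbitrary: \<sigma> \<tau>)
  case (Forall \<phi>)
  have "under_binder \<sigma> n = under_binder \<tau> n" if "n \<in> fv \<phi>" for n
    using that Forall.prems by (cases n) simp_all
  then have "subst (under_binder \<sigma>) \<phi> = subst (under_binder \<tau>) \<phi>" by (rule Forall.IH)
  then show ?case by simp
next
  case (Exists \<phi>)
  have "under_binder \<sigma> n = under_binder \<tau> n" if "n \<in> fv \<phi>" for n
    using that Exists.prems by (cases n) simp_all
  then have "subst (under_binder \<sigma>) \<phi> = subst (under_binder \<tau>) \<phi>" by (rule Exists.IH)
  then show ?case by simp
qed (simp_all (no_asm), (metis fv.simps UnI1 UnI2 subst_tm_cong)+)

lemma subst_sentence: "sentence \<phi> \<Longrightarrow> subst \<sigma> \<phi> = \<phi>"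
  using subst_cong[of \<phi> \<sigma> Var] by (simp add: sentence_def)

lemma fv_subst_tm: "fv_tm (subst_tm \<sigma> t) = (\<Union>n\<in>fv_tm t. fv_tm (\<sigma> n))"
  by (induction t) auto

lemma fv_under_binder: "Suc n \<in> fv_tm (under_binder \<sigma> m) \<Longrightarrow> \<exists>k. m = Suc k \<and> n \<in> fv_tm (\<sigma> k)"
  by (cases m) (auto simp: lift_tm_def fv_subst_tm)

lemma fv_subst: "fv (subst \<sigma> \<phi>) \<subseteq> (\<Union>n\<in>fv \<phi>. fv_tm (\<sigma> n))"
proof (induction \<phi> arbitrary: \<sigma>)
  case (Forall \<phi>)
  then show ?case using fv_under_binder by fastforce
next
  case (Exists \<phi>)
  then show ?case using fv_under_binder by fastforce
qed (auto simp: fv_subst_tm, blast+)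

lemma subst_nat_tm [simp]: "subst_tm \<sigma> (nat_tm n) = nat_tm n"
  by (induction n) simp_all

lemma lift_nat_tm [simp]: "lift_tm (nat_tm n) = nat_tm n"
  by (simp add: lift_tm_def)

lemma fv_nat_tm [simp]: "fv_tm (nat_tm n) = {}"
  by (induction n) simp_all

lemma sentence_apply_code: "fv P \<subseteq> {0} \<Longrightarrow> sentence (apply_code cf P \<phi>)"
  unfolding sentence_def apply_code_def inst_def
  using fv_subst[of "case_nat (nat_tm (cf \<phi>)) Var" P] by (fastforce split: nat.splits)

lemma inst_under_binder: "inst (subst (under_binder \<sigma>) \<phi>) t = subst (case_nat t \<sigma>) \<phi>"
proof -
  have "subst_tm (case_nat t Var) (under_binder \<sigma> n) = case_nat t \<sigma> n" for n
    by (cases n) simp_all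
  then show ?thesis by (simp add: inst_def subst_subst)
qed


section \<open>Derived rules of the calculus\<close>

lemma weaken: "\<Gamma> \<turnstile> \<phi> \<Longrightarrow> \<Gamma> \<subseteq> \<Delta> \<Longrightarrow> \<Delta> \<turnstile> \<phi>"
proof (induction arbitrary: \<Delta> rule: proves.induct)
  case (NegI \<phi> \<Gamma> \<psi>)
  then show ?case by (meson insert_mono proves.NegI)
next
  case (Contr \<phi> \<Gamma> \<psi>)
  then show ?case by (meson insert_mono proves.Contr)
next
  case (DisjE \<Gamma> \<phi> \<psi> \<chi>)
  then show ?case by (meson insert_mono proves.DisjE)
next
  case (ImpI \<phi> \<Gamma> \<psi>)
  then show ?case by (meson insert_mono proves.ImpI)
next
  case (ForallI \<Gamma> \<phi>)
  then show ?case by (meson image_mono proves.ForallI)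
next
  case (ExistsE \<Gamma> \<phi> \<psi>)
  then show ?case by (meson image_mono insert_mono proves.ExistsE)
qed (blast intro: Assm, (metis ConjI ConjE1 ConjE2 DisjI1 DisjI2 ImpE ForallE ExistsI EqRefl EqSubst)+)

lemma weaken_insert: "\<Gamma> \<turnstile> \<phi> \<Longrightarrow> insert \<psi> \<Gamma> \<turnstile> \<phi>"
  by (erule weaken) blast

lemma assm_insert: "insert \<phi> \<Gamma> \<turnstile> \<phi>"
  by (simp add: Assm)

lemma cut: "\<Gamma> \<turnstile> \<phi> \<Longrightarrow> insert \<phi> \<Gamma> \<turnstile> \<psi> \<Longrightarrow> \<Gamma> \<turnstile> \<psi>"
  by (rule ImpE[OF ImpI])

lemma explosion: "\<Gamma> \<turnstile> \<phi> \<Longrightarrow> \<Gamma> \<turnstile> Neg \<phi> \<Longrightarrow> \<Gamma> \<turnstile> \<psi>"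
  by (rule Contr[OF weaken_insert weaken_insert])

lemma reductio: "insert \<phi> \<Gamma> \<turnstile> \<psi> \<Longrightarrow> \<Gamma> \<turnstile> Neg \<psi> \<Longrightarrow> \<Gamma> \<turnstile> Neg \<phi>"
  by (rule NegI[OF _ weaken_insert])

lemma NegNegI: "\<Gamma> \<turnstile> \<phi> \<Longrightarrow> \<Gamma> \<turnstile> Neg (Neg \<phi>)"
  by (rule NegI[OF weaken_insert assm_insert])

lemma NegNegE: "\<Gamma> \<turnstile> Neg (Neg \<phi>) \<Longrightarrow> \<Gamma> \<turnstile> \<phi>"
  by (rule Contr[OF assm_insert weaken_insert])

lemma excluded_middle_cases: "insert \<phi> \<Gamma> \<turnstile> \<chi> \<Longrightarrow> insert (Neg \<phi>) \<Gamma> \<turnstile> \<chi> \<Longrightarrow> \<Gamma> \<turnstile> \<chi>"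
proof (rule Contr[of \<chi> \<Gamma> \<chi>])
  assume pos: "insert \<phi> \<Gamma> \<turnstile> \<chi>" and neg: "insert (Neg \<phi>) \<Gamma> \<turnstile> \<chi>"
  have "insert \<phi> (insert (Neg \<chi>) \<Gamma>) \<turnstile> \<chi>" using pos by (rule weaken) auto
  then have "insert (Neg \<chi>) \<Gamma> \<turnstile> Neg \<phi>" by (rule reductio) (rule assm_insert)
  moreover have "insert (Neg \<phi>) (insert (Neg \<chi>) \<Gamma>) \<turnstile> \<chi>" using neg by (rule weaken) auto
  ultimately show "insert (Neg \<chi>) \<Gamma> \<turnstile> \<chi>" by (rule cut)
qed (rule assm_insert)

lemma Iff_of_refuted: "\<Gamma> \<turnstile> Neg \<phi> \<Longrightarrow> \<Gamma> \<turnstile> Neg \<psi> \<Longrightarrow> \<Gamma> \<turnstile> Iff \<phi> \<psi>"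
  unfolding Iff_def by (rule ConjI; rule ImpI; rule explosion[OF assm_insert]; rule weaken_insert)

text \<open>Congruence for arbitrary terms, with variable 0 of \<open>u\<close> marking the place of replacement.\<close>

lemma Eq_cong:
  assumes "\<Gamma> \<turnstile> Eq a b"
  shows "\<Gamma> \<turnstile> Eq (subst_tm (case_nat a Var) u) (subst_tm (case_nat b Var) u)"
  using EqSubst[OF assms, of "Eq (lift_tm (subst_tm (case_nat a Var) u)) u"]
  by (simp add: inst_def EqRefl)

lemma Eq_sym: "\<Gamma> \<turnstile> Eq a b \<Longrightarrow> \<Gamma> \<turnstile> Eq b a"
  using EqSubst[of \<Gamma> a b "Eq (Var 0) (lift_tm a)"] by (simp add: inst_def EqRefl)

lemma Eq_trans: "\<Gamma> \<turnstile> Eq a b \<Longrightarrow> \<Gamma> \<turnstile> Eq b c \<Longrightarrow> \<Gamma> \<turnstile> Eq a c"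
  using EqSubst[of \<Gamma> b c "Eq (lift_tm a) (Var 0)"] by (simp add: inst_def)

lemma Eq_Succ: "\<Gamma> \<turnstile> Eq a b \<Longrightarrow> \<Gamma> \<turnstile> Eq (Succ a) (Succ b)"
  using Eq_cong[of \<Gamma> a b "Succ (Var 0)"] by simp

lemma Eq_Plus: "\<Gamma> \<turnstile> Eq a b \<Longrightarrow> \<Gamma> \<turnstile> Eq c d \<Longrightarrow> \<Gamma> \<turnstile> Eq (Plus a c) (Plus b d)"
  by (rule Eq_trans[OF Eq_cong[of \<Gamma> a b "Plus (Var 0) (lift_tm c)", simplified]
        Eq_cong[of \<Gamma> c d "Plus (lift_tm b) (Var 0)", simplified]])

lemma Eq_Times: "\<Gamma> \<turnstile> Eq a b \<Longrightarrow> \<Gamma> \<turnstile> Eq c d \<Longrightarrow> \<Gamma> \<turnstile> Eq (Times a c) (Times b d)"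
  by (rule Eq_trans[OF Eq_cong[of \<Gamma> a b "Times (Var 0) (lift_tm c)", simplified]
        Eq_cong[of \<Gamma> c d "Times (lift_tm b) (Var 0)", simplified]])

lemma Le_cong: "\<Gamma> \<turnstile> Eq a b \<Longrightarrow> \<Gamma> \<turnstile> Eq c d \<Longrightarrow> \<Gamma> \<turnstile> Le a c \<Longrightarrow> \<Gamma> \<turnstile> Le b d"
  using EqSubst[of \<Gamma> a b "Le (Var 0) (lift_tm c)"] EqSubst[of \<Gamma> c d "Le (lift_tm b) (Var 0)"]
  by (simp add: inst_def)


section \<open>The axioms of Robinson's arithmetic at arbitrary terms\<close>

lemma Forall2E:
  "\<Gamma> \<turnstile> Forall (Forall \<phi>) \<Longrightarrow> \<Gamma> \<turnstile> subst (case_nat t (case_nat s Var)) \<phi>"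
  using ForallE[of \<Gamma> "subst (under_binder (case_nat s Var)) \<phi>" t, unfolded inst_under_binder]
    ForallE[of \<Gamma> "Forall \<phi>" s]
  by (simp add: inst_def)

context
  fixes \<Gamma> assumes Q: "Q \<subseteq> \<Gamma>"
begin

lemma Succ_not_Zero: "\<Gamma> \<turnstile> Neg (Eq (Succ t) Zero)"
  using ForallE[OF Assm, of "Neg (Eq (Succ (Var 0)) Zero)" \<Gamma> t] Q by (simp add: inst_def Q_def)

lemma Succ_inject: "\<Gamma> \<turnstile> Eq (Succ s) (Succ t) \<Longrightarrow> \<Gamma> \<turnstile> Eq s t"
proof (rule ImpE)
  show "\<Gamma> \<turnstile> Imp (Eq (Succ s) (Succ t)) (Eq s t)"
    using Forall2E[OF Assm, of "Imp (Eq (Succ (Var 1)) (Succ (Var 0))) (Eq (Var 1) (Var 0))" \<Gamma> t s] Q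
    by (simp add: Q_def)
qed

lemma predecessor:
  "\<Gamma> \<turnstile> Neg (Eq t Zero) \<Longrightarrow> \<Gamma> \<turnstile> Exists (Eq (lift_tm t) (Succ (Var 0)))"
proof (rule ImpE)
  show "\<Gamma> \<turnstile> Imp (Neg (Eq t Zero)) (Exists (Eq (lift_tm t) (Succ (Var 0))))"
    using ForallE[OF Assm,
        of "Imp (Neg (Eq (Var 0) Zero)) (Exists (Eq (Var 1) (Succ (Var 0))))" \<Gamma> t] Q
    by (simp add: Q_def inst_def)
qed

lemma Plus_Zero: "\<Gamma> \<turnstile> Eq (Plus t Zero) t"
  using ForallE[OF Assm, of "Eq (Plus (Var 0) Zero) (Var 0)" \<Gamma> t] Q by (simp add: inst_def Q_def)

lemma Plus_Succ: "\<Gamma> \<turnstile> Eq (Plus s (Succ t)) (Succ (Plus s t))"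
  using Forall2E[OF Assm,
      of "Eq (Plus (Var 1) (Succ (Var 0))) (Succ (Plus (Var 1) (Var 0)))" \<Gamma> t s] Q
  by (simp add: Q_def)

lemma Times_Zero: "\<Gamma> \<turnstile> Eq (Times t Zero) Zero"
  using ForallE[OF Assm, of "Eq (Times (Var 0) Zero) Zero" \<Gamma> t] Q by (simp add: inst_def Q_def)

lemma Times_Succ: "\<Gamma> \<turnstile> Eq (Times s (Succ t)) (Plus (Times s t) s)"
  using Forall2E[OF Assm,
      of "Eq (Times (Var 1) (Succ (Var 0))) (Plus (Times (Var 1) (Var 0)) (Var 1))" \<Gamma> t s] Q
  by (simp add: Q_def)

lemma Le_iff:
  "\<Gamma> \<turnstile> Iff (Le s t) (Exists (Eq (Plus (Var 0) (lift_tm s)) (lift_tm t)))"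
  using Forall2E[OF Assm,
      of "Iff (Le (Var 1) (Var 0)) (Exists (Eq (Plus (Var 0) (Var 2)) (Var 1)))" \<Gamma> t s] Q
  by (simp add: Q_def Iff_def under_binder_def numeral_2_eq_2)

end

text \<open>The axioms are sentences, so they survive the lifting of the context in the quantifier rules.\<close>

lemma lift_Q: "lift ` Q = Q"
  by (simp add: Q_def lift_def Iff_def under_binder_def lift_tm_def numeral_2_eq_2)

lemma Q_subset_lift: "Q \<subseteq> \<Gamma> \<Longrightarrow> Q \<subseteq> insert \<phi> (lift ` \<Gamma>)"
  using lift_Q by blast


section \<open>Closed terms and numerals\<close>

lemma Plus_numerals: "Q \<turnstile> Eq (Plus (nat_tm m) (nat_tm n)) (nat_tm (m + n))"
proof (induction n)
  case 0
  then show ?case by (simp add: Plus_Zero)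
next
  case (Suc n)
  then show ?case using Eq_trans[OF Plus_Succ Eq_Succ] by simp
qed

lemma Times_numerals: "Q \<turnstile> Eq (Times (nat_tm m) (nat_tm n)) (nat_tm (m * n))"
proof (induction n)
  case 0
  then show ?case by (simp add: Times_Zero)
next
  case (Suc n)
  have "Q \<turnstile> Eq (Times (nat_tm m) (nat_tm (Suc n))) (Plus (nat_tm (m * n)) (nat_tm m))"
    using Eq_trans[OF Times_Succ Eq_Plus[OF Suc EqRefl]] by simp
  from Eq_trans[OF this Plus_numerals] show ?case by (simp add: add.commute)
qed

abbreviation numerals :: "(nat \<Rightarrow> nat) \<Rightarrow> nat \<Rightarrow> tm" where
  "numerals e \<equiv> \<lambda>n. nat_tm (e n)"

lemma Q_evaluates: "Q \<turnstile> Eq (subst_tm (numerals e) t) (nat_tm (val e t))"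
proof (induction t)
  case (Plus s t)
  then show ?case using Eq_trans[OF Eq_Plus Plus_numerals] by simp
next
  case (Times s t)
  then show ?case using Eq_trans[OF Eq_Times Times_numerals] by simp
qed (simp_all add: EqRefl Eq_Succ)

lemma distinct_numerals: "m \<noteq> n \<Longrightarrow> Q \<turnstile> Neg (Eq (nat_tm m) (nat_tm n))"
proof (induction m arbitrary: n)
  case 0
  then obtain k where n: "n = Suc k" by (cases n) auto
  have "insert (Eq Zero (Succ (nat_tm k))) Q \<turnstile> Eq (Succ (nat_tm k)) Zero"
    by (rule Eq_sym) (rule assm_insert)
  then have "Q \<turnstile> Neg (Eq Zero (Succ (nat_tm k)))"
    by (rule reductio) (simp add: Succ_not_Zero)
  then show ?case by (simp add: n)
next
  case (Suc m)
  show ?case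
  proof (cases n)
    case 0
    then show ?thesis by (simp add: Succ_not_Zero)
  next
    case (Suc k)
    have "insert (Eq (Succ (nat_tm m)) (Succ (nat_tm k))) Q \<turnstile> Eq (nat_tm m) (nat_tm k)"
      by (rule Succ_inject) (auto intro: assm_insert)
    then have "Q \<turnstile> Neg (Eq (Succ (nat_tm m)) (Succ (nat_tm k)))"
      by (rule reductio) (use Suc Suc.IH Suc.prems in simp)
    then show ?thesis by (simp add: Suc)
  qed
qed

lemma numerals_Le: "m \<le> n \<Longrightarrow> Q \<turnstile> Le (nat_tm m) (nat_tm n)"
proof -
  assume "m \<le> n"
  then have "Q \<turnstile> inst (Eq (Plus (Var 0) (nat_tm m)) (nat_tm n)) (nat_tm (n - m))"
    using Plus_numerals[of "n - m" m] by (simp add: inst_def)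
  then have "Q \<turnstile> Exists (Eq (Plus (Var 0) (nat_tm m)) (nat_tm n))" by (rule ExistsI)
  moreover have "Q \<turnstile> Imp (Exists (Eq (Plus (Var 0) (nat_tm m)) (nat_tm n))) (Le (nat_tm m) (nat_tm n))"
    using ConjE2[OF Le_iff[unfolded Iff_def], of Q "nat_tm m" "nat_tm n"] by simp
  ultimately show ?thesis by (rule ImpE[rotated])
qed


section \<open>Below a numeral there are only numerals\<close>

text \<open>A finite disjunction, and not an elimination rule with one premise per numeral, because a
  formula can be carried through the lifting in the existential elimination rule.\<close>

primrec equals_upto :: "nat \<Rightarrow> tm \<Rightarrow> fm" where
  "equals_upto 0 x = Eq x Zero"
| "equals_upto (Suc n) x = Disj (equals_upto n x) (Eq x (nat_tm (Suc n)))"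

lemma lift_equals_upto: "lift (equals_upto n x) = equals_upto n (lift_tm x)"
  by (induction n) (simp_all add: lift_def lift_tm_def)

lemma equals_uptoI: "k \<le> n \<Longrightarrow> \<Gamma> \<turnstile> Eq x (nat_tm k) \<Longrightarrow> \<Gamma> \<turnstile> equals_upto n x"
proof (induction n)
  case (Suc n)
  then show ?case by (cases "k = Suc n") (auto intro: DisjI1 DisjI2)
qed simp

lemma equals_uptoE:
  "\<Gamma> \<turnstile> equals_upto n x \<Longrightarrow> (\<And>k. k \<le> n \<Longrightarrow> insert (Eq x (nat_tm k)) \<Gamma> \<turnstile> \<chi>) \<Longrightarrow> \<Gamma> \<turnstile> \<chi>"
proof (induction n arbitrary: \<Gamma>)
  case 0
  from cut[OF 0(1)] 0(2)[of 0] show ?case by simp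
next
  case (Suc n)
  show ?case
  proof (rule DisjE)
    show "\<Gamma> \<turnstile> Disj (equals_upto n x) (Eq x (nat_tm (Suc n)))" using Suc.prems(1) by simp
    show "insert (Eq x (nat_tm (Suc n))) \<Gamma> \<turnstile> \<chi>" by (rule Suc.prems(2)) simp
    show "insert (equals_upto n x) \<Gamma> \<turnstile> \<chi>"
    proof (rule Suc.IH[OF assm_insert])
      fix k assume "k \<le> n"
      then have "insert (Eq x (nat_tm k)) \<Gamma> \<turnstile> \<chi>" by (intro Suc.prems(2)) simp
      then show "insert (Eq x (nat_tm k)) (insert (equals_upto n x) \<Gamma>) \<turnstile> \<chi>"
        by (rule weaken) auto
    qed
  qed
qed

text \<open>Induction on \<open>n\<close>: either \<open>x\<close> is 0, or \<open>x = S x'\<close>, and then \<open>z + x = S (z + x')\<close>, which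
  contradicts \<open>n = 0\<close> and otherwise bounds \<open>x'\<close> by the predecessor of \<open>n\<close>.  The equation is a member
  of the context, and not merely derivable from it, so that lifting the context keeps it
  available.\<close>

lemma summand_of_numeral:
  "Q \<subseteq> \<Gamma> \<Longrightarrow> Eq (Plus z x) (nat_tm n) \<in> \<Gamma> \<Longrightarrow> \<Gamma> \<turnstile> equals_upto n x"
proof (induction n arbitrary: \<Gamma> z x)
  case (0 \<Gamma>)
  note Q = 0(1)
  let ?\<Delta> = "insert (Neg (Eq x Zero)) \<Gamma>"
  let ?E = "insert (Eq (lift_tm x) (Succ (Var 0))) (lift ` ?\<Delta>)"
  have E: "Q \<subseteq> ?E" using Q by (intro Q_subset_lift) auto
  have "lift (Eq (Plus z x) (nat_tm 0)) \<in> ?E" using 0(2) by blast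
  then have "?E \<turnstile> lift (Eq (Plus z x) (nat_tm 0))" by (rule Assm)
  then have sum: "?E \<turnstile> Eq (Plus (lift_tm z) (lift_tm x)) Zero" by (simp add: lift_def lift_tm_def)
  have "?E \<turnstile> Eq (Plus (lift_tm z) (lift_tm x)) (Succ (Plus (lift_tm z) (Var 0)))"
    by (rule Eq_trans[OF Eq_Plus[OF EqRefl assm_insert] Plus_Succ[OF E]])
  from Eq_trans[OF Eq_sym[OF this] sum]
  have contradiction: "?E \<turnstile> lift (Eq x Zero)" by (rule explosion) (rule Succ_not_Zero[OF E])
  have "\<Gamma> \<turnstile> Eq x Zero"
  proof (rule excluded_middle_cases[OF assm_insert])
    have "?\<Delta> \<turnstile> Exists (Eq (lift_tm x) (Succ (Var 0)))"
      using Q by (intro predecessor assm_insert) auto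
    then show "?\<Delta> \<turnstile> Eq x Zero" using contradiction by (rule ExistsE)
  qed
  then show ?case by simp
next
  case (Suc n \<Gamma>)
  note Q = Suc.prems(1)
  let ?\<Delta> = "insert (Neg (Eq x Zero)) \<Gamma>"
  let ?E = "insert (Eq (lift_tm x) (Succ (Var 0))) (lift ` ?\<Delta>)"
  have E: "Q \<subseteq> ?E" using Q by (intro Q_subset_lift) auto
  have "lift (Eq (Plus z x) (nat_tm (Suc n))) \<in> ?E"
    using Suc.prems(2) by blast
  then have "?E \<turnstile> lift (Eq (Plus z x) (nat_tm (Suc n)))" by (rule Assm)
  then have sum: "?E \<turnstile> Eq (Plus (lift_tm z) (lift_tm x)) (Succ (nat_tm n))"
    by (simp add: lift_def lift_tm_def)
  have "?E \<turnstile> Eq (Plus (lift_tm z) (lift_tm x)) (Succ (Plus (lift_tm z) (Var 0)))"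
    by (rule Eq_trans[OF Eq_Plus[OF EqRefl assm_insert] Plus_Succ[OF E]])
  from Succ_inject[OF E Eq_trans[OF Eq_sym[OF this] sum]]
  have "?E \<turnstile> Eq (Plus (lift_tm z) (Var 0)) (nat_tm n)" .
  then have "?E \<turnstile> equals_upto n (Var 0)"
    proof (rule cut)
    show "insert (Eq (Plus (lift_tm z) (Var 0)) (nat_tm n)) ?E \<turnstile> equals_upto n (Var 0)"
      using E by (intro Suc.IH[of _ "lift_tm z"]) blast+
  qed
  then have step: "?E \<turnstile> lift (equals_upto (Suc n) x)"
  proof (rule equals_uptoE)
    fix k assume "k \<le> n"
    have "insert (Eq (Var 0) (nat_tm k)) ?E \<turnstile> Eq (lift_tm x) (nat_tm (Suc k))"
      using Eq_trans[OF weaken_insert[OF assm_insert] Eq_Succ[OF assm_insert]] by simp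
    with \<open>k \<le> n\<close> show "insert (Eq (Var 0) (nat_tm k)) ?E \<turnstile> lift (equals_upto (Suc n) x)"
      unfolding lift_equals_upto by (intro equals_uptoI[of "Suc k"]) auto
  qed
  show ?case
  proof (rule excluded_middle_cases)
    have "insert (Eq x Zero) \<Gamma> \<turnstile> Eq x (nat_tm 0)" by (simp add: assm_insert)
    then show "insert (Eq x Zero) \<Gamma> \<turnstile> equals_upto (Suc n) x"
      by (intro equals_uptoI[of 0]) auto
    have "?\<Delta> \<turnstile> Exists (Eq (lift_tm x) (Succ (Var 0)))"
      using Q by (intro predecessor assm_insert) auto
    then show "?\<Delta> \<turnstile> equals_upto (Suc n) x" using step by (rule ExistsE)
  qed
qed

lemma Le_numeral:
  assumes Q: "Q \<subseteq> \<Gamma>" and le: "\<Gamma> \<turnstile> Le x (nat_tm n)"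
  shows "\<Gamma> \<turnstile> equals_upto n x"
proof (rule ExistsE)
  show "\<Gamma> \<turnstile> Exists (Eq (Plus (Var 0) (lift_tm x)) (nat_tm n))"
    using ImpE[OF ConjE1[OF Le_iff[OF Q, unfolded Iff_def]] le] by simp
  show "insert (Eq (Plus (Var 0) (lift_tm x)) (nat_tm n)) (lift ` \<Gamma>) \<turnstile> lift (equals_upto n x)"
    unfolding lift_equals_upto
    by (rule summand_of_numeral) (use Q_subset_lift[OF Q] in auto)
qed

lemma numerals_not_Le:
  assumes "n < m"
  shows "Q \<turnstile> Neg (Le (nat_tm m) (nat_tm n))"
proof -
  let ?\<Gamma> = "insert (Le (nat_tm m) (nat_tm n)) Q"
  have "?\<Gamma> \<turnstile> equals_upto n (nat_tm m)"
    by (intro Le_numeral assm_insert) auto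
  then have "?\<Gamma> \<turnstile> Eq Zero (Succ Zero)"
  proof (rule equals_uptoE)
    fix k assume "k \<le> n"
    with assms have "Q \<turnstile> Neg (Eq (nat_tm m) (nat_tm k))" by (intro distinct_numerals) auto
    then show "insert (Eq (nat_tm m) (nat_tm k)) ?\<Gamma> \<turnstile> Eq Zero (Succ Zero)"
      by (rule explosion[OF assm_insert weaken_insert[OF weaken_insert]])
  qed
  then show ?thesis
    by (rule reductio) (use distinct_numerals[of 0 1] in simp)
qed


section \<open>\<open>\<Sigma>\<^sub>1\<close>-completeness\<close>

lemma under_binder_numerals: "under_binder (numerals e) = case_nat (Var 0) (numerals e)"
  by (rule ext) (simp add: under_binder_def split: nat.split)

lemma numerals_case_nat: "numerals (case_nat a e) = case_nat (nat_tm a) (numerals e)"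
  by (rule ext) (simp split: nat.split)

lemma inst_numeral:
  "inst (subst (under_binder (numerals e)) \<phi>) (nat_tm a) = subst (numerals (case_nat a e)) \<phi>"
  by (simp add: inst_under_binder numerals_case_nat)

text \<open>Provided the remaining variables are numerals, all properties of variable 0 that hold for the
  finitely many numerals up to the bound transfer to variable 0 itself, by the replacement rule.\<close>

lemma bounded_generalization:
  assumes inst: "\<And>a. a \<le> val e t \<Longrightarrow> Q \<turnstile> subst (numerals (case_nat a e)) \<phi>"
  shows "insert (Le (Var 0) (subst_tm (numerals e) t)) Q \<turnstile> subst (under_binder (numerals e)) \<phi>"
    (is "?\<Gamma> \<turnstile> ?\<phi>")
proof -
  have "?\<Gamma> \<turnstile> Le (Var 0) (nat_tm (val e t))"
    by (rule Le_cong[OF EqRefl weaken_insert[OF Q_evaluates] assm_insert])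
  then have "?\<Gamma> \<turnstile> equals_upto (val e t) (Var 0)" by (intro Le_numeral) auto
  then show ?thesis
  proof (rule equals_uptoE)
    fix a assume "a \<le> val e t"
    let ?\<Delta> = "insert (Eq (Var 0) (nat_tm a)) ?\<Gamma>"
    have "?\<Delta> \<turnstile> inst ?\<phi> (nat_tm a)"
      using inst[OF \<open>a \<le> val e t\<close>] by (intro weaken_insert) (simp add: inst_numeral)
    with Eq_sym[OF assm_insert] have "?\<Delta> \<turnstile> inst ?\<phi> (Var 0)" by (rule EqSubst)
    then show "?\<Delta> \<turnstile> ?\<phi>" by (simp only: inst_under_binder) (simp only: under_binder_numerals)
  qed
qed

lemma val_lift_tm: "val (case_nat a e) (lift_tm t) = val e t"
  by (induction t) (simp_all add: lift_tm_def)

lemma inst_bounded: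
  fixes e t \<phi> a
  defines "b \<equiv> subst_tm (numerals e) t" and "\<phi>' \<equiv> subst (under_binder (numerals e)) \<phi>"
  shows "inst (Imp (Le (Var 0) b) \<phi>') (nat_tm a) = Imp (Le (nat_tm a) b) (subst (numerals (case_nat a e)) \<phi>)"
    and "inst (Conj (Le (Var 0) b) \<phi>') (nat_tm a) = Conj (Le (nat_tm a) b) (subst (numerals (case_nat a e)) \<phi>)"
  using inst_numeral[of e \<phi> a] unfolding b_def \<phi>'_def inst_def by (simp_all add: subst_tm_subst_tm)

text \<open>Refuting is carried along with proving because negation and implication exchange the two.  For a
  bounded quantifier, one of the two follows from a single numeral instance and the other from
  \<open>bounded_generalization\<close>.\<close>

lemma Q_decides_Delta0:
  "Delta0 \<phi> \<Longrightarrow>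
    (sat e \<phi> \<longrightarrow> Q \<turnstile> subst (numerals e) \<phi>) \<and>
    (\<not> sat e \<phi> \<longrightarrow> Q \<turnstile> Neg (subst (numerals e) \<phi>))"
proof (induction arbitrary: e rule: Delta0.induct)
  case (1 s t)
  let ?E = "Eq (subst_tm (numerals e) s) (subst_tm (numerals e) t)"
  have pos: "Q \<turnstile> ?E" if "val e s = val e t"
    using Eq_trans[OF Q_evaluates[of e s] Eq_sym[OF Q_evaluates[of e t, folded that]]] .
  have neg: "Q \<turnstile> Neg ?E" if "val e s \<noteq> val e t"
  proof (rule reductio[OF _ distinct_numerals[OF that]])
    show "insert ?E Q \<turnstile> Eq (nat_tm (val e s)) (nat_tm (val e t))"
      by (rule Eq_trans[OF Eq_sym[OF weaken_insert[OF Q_evaluates]]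
            Eq_trans[OF assm_insert weaken_insert[OF Q_evaluates]]])
  qed
  from pos neg show ?case by simp
next
  case (2 s t)
  let ?L = "Le (subst_tm (numerals e) s) (subst_tm (numerals e) t)"
  have pos: "Q \<turnstile> ?L" if "val e s \<le> val e t"
    by (rule Le_cong[OF Eq_sym[OF Q_evaluates] Eq_sym[OF Q_evaluates] numerals_Le[OF that]])
  have neg: "Q \<turnstile> Neg ?L" if "\<not> val e s \<le> val e t"
  proof (rule reductio[OF _ numerals_not_Le])
    show "insert ?L Q \<turnstile> Le (nat_tm (val e s)) (nat_tm (val e t))"
      by (rule Le_cong[OF weaken_insert[OF Q_evaluates] weaken_insert[OF Q_evaluates] assm_insert])
    show "val e t < val e s" using that by simp
  qed
  from pos neg show ?case by simp
next
  case (3 \<phi>)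
  then show ?case by (auto intro: NegNegI)
next
  case (4 \<phi> \<psi>)
  then show ?case
    by (auto intro: ConjI reductio[OF ConjE1[OF assm_insert]] reductio[OF ConjE2[OF assm_insert]])
next
  case (5 \<phi> \<psi>)
  have "Q \<turnstile> Neg (Disj A B)" if "Q \<turnstile> Neg A" "Q \<turnstile> Neg B" for A B
  proof (rule reductio[OF _ that(2)])
    show "insert (Disj A B) Q \<turnstile> B"
      by (rule DisjE[OF assm_insert explosion[OF assm_insert] assm_insert])
        (intro weaken_insert that(1))
  qed
  with 5 show ?case by (auto intro: DisjI1 DisjI2)
next
  case (6 \<phi> \<psi>)
  have "Q \<turnstile> Neg (Imp A B)" if "Q \<turnstile> A" "Q \<turnstile> Neg B" for A B
    by (rule reductio[OF ImpE[OF assm_insert weaken_insert[OF that(1)]] that(2)])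
  moreover have "Q \<turnstile> Imp A B" if "Q \<turnstile> Neg A" for A B
    by (rule ImpI[OF explosion[OF assm_insert weaken_insert[OF that]]])
  moreover have "Q \<turnstile> Imp A B" if "Q \<turnstile> B" for A B
    by (rule ImpI[OF weaken_insert[OF that]])
  ultimately show ?case using 6 by auto
next
  case (7 \<phi> t)
  let ?b = "subst_tm (numerals e) t" and ?\<phi> = "subst (under_binder (numerals e)) \<phi>"
  let ?A = "Forall (Imp (Le (Var 0) ?b) ?\<phi>)"
  have pos: "Q \<turnstile> ?A" if "\<And>a. a \<le> val e t \<Longrightarrow> sat (case_nat a e) \<phi>"
  proof (rule ForallI)
    show "lift ` Q \<turnstile> Imp (Le (Var 0) ?b) ?\<phi>"
      unfolding lift_Q using 7 that by (intro ImpI bounded_generalization) blast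
  qed
  have neg: "Q \<turnstile> Neg ?A" if "a \<le> val e t" "\<not> sat (case_nat a e) \<phi>" for a
  proof (rule reductio)
    have "Q \<turnstile> Le (nat_tm a) ?b"
      by (rule Le_cong[OF EqRefl Eq_sym[OF Q_evaluates] numerals_Le[OF that(1)]])
    moreover have "insert ?A Q \<turnstile> inst (Imp (Le (Var 0) ?b) ?\<phi>) (nat_tm a)"
      by (rule ForallE[OF assm_insert])
    then have "insert ?A Q \<turnstile> Imp (Le (nat_tm a) ?b) (subst (numerals (case_nat a e)) \<phi>)"
      unfolding inst_bounded .
    ultimately show "insert ?A Q \<turnstile> subst (numerals (case_nat a e)) \<phi>"
      by (rule ImpE[OF _ weaken_insert, rotated])
    show "Q \<turnstile> Neg (subst (numerals (case_nat a e)) \<phi>)" using 7 that(2) by blast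
  qed
  from pos neg show ?case by (auto simp: val_lift_tm)
next
  case (8 \<phi> t)
  let ?b = "subst_tm (numerals e) t" and ?\<phi> = "subst (under_binder (numerals e)) \<phi>"
  let ?B = "Conj (Le (Var 0) ?b) ?\<phi>"
  have pos: "Q \<turnstile> Exists ?B" if "a \<le> val e t" "sat (case_nat a e) \<phi>" for a
  proof (rule ExistsI)
    have "Q \<turnstile> Le (nat_tm a) ?b"
      by (rule Le_cong[OF EqRefl Eq_sym[OF Q_evaluates] numerals_Le[OF that(1)]])
    moreover have "Q \<turnstile> subst (numerals (case_nat a e)) \<phi>" using 8 that(2) by blast
    ultimately show "Q \<turnstile> inst ?B (nat_tm a)" unfolding inst_bounded by (simp add: ConjI)
  qed
  have neg: "Q \<turnstile> Neg (Exists ?B)" if none: "\<And>a. a \<le> val e t \<Longrightarrow> \<not> sat (case_nat a e) \<phi>"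
  proof (rule reductio)
    have "insert (Le (Var 0) ?b) Q \<turnstile> subst (under_binder (numerals e)) (Neg \<phi>)"
      using 8 none by (intro bounded_generalization) simp
    then have "Q \<turnstile> Imp (Le (Var 0) ?b) (Neg ?\<phi>)" by (simp add: ImpI)
    then have "insert ?B Q \<turnstile> Neg ?\<phi>"
      by (rule ImpE[OF weaken_insert ConjE1[OF assm_insert]])
    \<comment> \<open>Any refutable sentence would do as the target; being closed, it contains no eigenvariable.\<close>
    with ConjE2[OF assm_insert] have "insert ?B Q \<turnstile> lift (Eq Zero (Succ Zero))"
      by (rule explosion)
    then have "insert ?B (lift ` insert (Exists ?B) Q) \<turnstile> lift (Eq Zero (Succ Zero))"
      by (rule weaken) (simp add: lift_Q, blast)
    then show "insert (Exists ?B) Q \<turnstile> Eq Zero (Succ Zero)" by (rule ExistsE[OF assm_insert])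
    show "Q \<turnstile> Neg (Eq Zero (Succ Zero))" using distinct_numerals[of 0 1] by simp
  qed
  from pos neg show ?case by (auto simp: val_lift_tm)
qed

text \<open>An unbounded existential quantifier has a numeral witness, and a failing universal quantifier a
  numeral counterexample; the two classes are treated together because negation exchanges them.\<close>

lemma Q_complete_for_Sigma1:
  shows "Sigma1 \<phi> \<Longrightarrow> sat e \<phi> \<Longrightarrow> Q \<turnstile> subst (numerals e) \<phi>"
    and "Pi1 \<psi> \<Longrightarrow> \<not> sat e \<psi> \<Longrightarrow> Q \<turnstile> Neg (subst (numerals e) \<psi>)"
proof (induction arbitrary: e and e rule: Sigma1_Pi1.inducts)
  case (1 \<phi>)
  then show ?case using Q_decides_Delta0 by blast
next
  case (2 \<phi>)
  then obtain a where "Q \<turnstile> subst (numerals (case_nat a e)) \<phi>" by fastforce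
  then have "Q \<turnstile> inst (subst (under_binder (numerals e)) \<phi>) (nat_tm a)" by (simp only: inst_numeral)
  then have "Q \<turnstile> Exists (subst (under_binder (numerals e)) \<phi>)" by (rule ExistsI)
  then show ?case by simp
next
  case (3 \<phi>)
  then show ?case by simp
next
  case (4 \<phi>)
  then show ?case using Q_decides_Delta0 by blast
next
  case (5 \<phi>)
  then obtain a where "Q \<turnstile> Neg (subst (numerals (case_nat a e)) \<phi>)" by fastforce
  then have "Q \<turnstile> Neg (inst (subst (under_binder (numerals e)) \<phi>) (nat_tm a))"
    by (simp only: inst_numeral)
  then have "Q \<turnstile> Neg (Forall (subst (under_binder (numerals e)) \<phi>))"
    by (rule reductio[OF ForallE[OF assm_insert]])
  then show ?case by simp
next
  case (6 \<phi>)
  then show ?case by (simp add: NegNegI)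
qed

lemma Q_refutes_false_Pi1:
  assumes "sentence \<phi>" "Pi1 \<phi>" "\<not> true_in_N \<phi>"
  shows "Q \<turnstile> Neg \<phi>"
proof -
  from assms(3) obtain e where "\<not> sat e \<phi>" unfolding true_in_N_def by blast
  from Q_complete_for_Sigma1(2)[OF assms(2) this] show ?thesis
    using subst_sentence[OF assms(1)] by simp
qed


section \<open>Goedelian sentences\<close>

theorem theorem2p4:
  fixes ct :: "tm \<Rightarrow> nat" and cf :: "fm \<Rightarrow> nat" and T :: "fm set" and P :: fm
  assumes "goedel_numbering ct cf"
    and "re_theory cf T"
    and "extends T Q"
    and "provability_predicate cf T P"
    and I: "\<And>\<phi>. sentence \<phi> \<Longrightarrow> T \<turnstile> Imp (Neg (Con cf P)) (apply_code cf P \<phi>)"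
    and II: "\<And>\<gamma>. goedelian cf P T \<gamma> \<Longrightarrow> T \<turnstile> Imp (Con cf P) (Neg (apply_code cf P \<gamma>))"
  shows "(T \<turnstile> Neg (Con cf P) \<longrightarrow>
            (\<forall>\<phi>. sentence \<phi> \<and> Pi1 \<phi> \<and> \<not> true_in_N \<phi> \<longrightarrow> goedelian cf P T \<phi>) \<and>
            \<not> (\<exists>\<gamma>. goedelian cf P T \<gamma> \<and> independent_from T \<gamma>)) \<and>
         (\<not> T \<turnstile> Neg (Con cf P) \<longrightarrow>
            (\<forall>\<gamma>. goedelian cf P T \<gamma> \<and> Pi1 \<gamma> \<longrightarrow> true_in_N \<gamma>) \<and>
            (\<forall>\<gamma>. goedelian cf P T \<gamma> \<longrightarrow> independent_from T \<gamma>))"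
proof -
  let ?Pr = "apply_code cf P"
  have refutes: "T \<turnstile> Neg \<phi>" if "sentence \<phi>" "Pi1 \<phi>" "\<not> true_in_N \<phi>" for \<phi>
    using Q_refutes_false_Pi1[OF that] assms(3) that(1) by (simp add: extends_def sentence_def)
  have necessitation: "T \<turnstile> ?Pr \<phi>" if "sentence \<phi>" "T \<turnstile> \<phi>" for \<phi>
    using assms(3,4) that sentence_apply_code[of P cf \<phi>]
    unfolding provability_predicate_def extends_def by blast
  have goedelianD: "sentence \<gamma>" "T \<turnstile> Imp \<gamma> (Neg (?Pr \<gamma>))" "T \<turnstile> Imp (Neg (?Pr \<gamma>)) \<gamma>"
    if "goedelian cf P T \<gamma>" for \<gamma>
    using that unfolding goedelian_def Iff_def by (blast intro: ConjE1 ConjE2)+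
  have contraposition: "T \<turnstile> Neg A" if "T \<turnstile> Imp A (Neg B)" "T \<turnstile> B" for A B
    by (rule reductio[OF ImpE[OF weaken_insert[OF that(1)] assm_insert] NegNegI[OF that(2)]])
  have Pr_all: "T \<turnstile> ?Pr \<phi>" if "T \<turnstile> Neg (Con cf P)" "sentence \<phi>" for \<phi>
    using ImpE[OF I[OF that(2)] that(1)] .
  have false_Pi1_goedelian: "goedelian cf P T \<phi>"
    if "T \<turnstile> Neg (Con cf P)" "sentence \<phi>" "Pi1 \<phi>" "\<not> true_in_N \<phi>" for \<phi>
    unfolding goedelian_def
    using that by (blast intro: Iff_of_refuted refutes NegNegI Pr_all)
  have not_independent: "\<not> independent_from T \<gamma>" if "T \<turnstile> Neg (Con cf P)" "goedelian cf P T \<gamma>" for \<gamma>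
    using contraposition[OF goedelianD(2) Pr_all] goedelianD(1) that
    unfolding independent_from_def by blast
  have independent: "independent_from T \<gamma>"
    if con: "\<not> T \<turnstile> Neg (Con cf P)" and \<gamma>: "goedelian cf P T \<gamma>" for \<gamma>
    unfolding independent_from_def
  proof (intro conjI notI)
    assume prov: "T \<turnstile> \<gamma>"
    then have "T \<turnstile> Neg \<gamma>"
      using contraposition[OF goedelianD(2)] necessitation goedelianD(1) \<gamma> by blast
    with prov have "T \<turnstile> Neg (Con cf P)" by (rule explosion)
    with con show False ..
  next
    assume "T \<turnstile> Neg \<gamma>"
    then have "T \<turnstile> Neg (Neg (?Pr \<gamma>))"
      by (rule reductio[OF ImpE[OF weaken_insert[OF goedelianD(3)[OF \<gamma>]] assm_insert]])
    then have "T \<turnstile> ?Pr \<gamma>" by (rule NegNegE)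
    then have "T \<turnstile> Neg (Con cf P)" by (rule contraposition[OF II[OF \<gamma>]])
    with con show False ..
  qed
  have Pi1_true: "true_in_N \<gamma>"
    if "\<not> T \<turnstile> Neg (Con cf P)" "goedelian cf P T \<gamma>" "Pi1 \<gamma>" for \<gamma>
    using independent refutes goedelianD(1) that unfolding independent_from_def by blast
  from false_Pi1_goedelian not_independent independent Pi1_true show ?thesis by blast
qed

end
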